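(* If $\{b_n\}_{n=1}^{\infty}$ is any sequence of positive real numbers with $b_n\ge 1$ for all $n\ge 1$, then the continued fraction $K_{n=1}^{\infty}\frac{b_n+1}{b_n}$ converges and $$K_{n=1}^{\infty}\frac{b_n+1}{b_n}=1 .$$
   Context: For sequences $\{a_n\}_{n\ge1}$, $\{b_n\}_{n\ge1}$, $K_{n=1}^{N}\frac{a_n}{b_n}$ denotes the finite continued fraction $\cfrac{a_1}{b_1+\cfrac{a_2}{b_2+\cdots+\cfrac{a_N}{b_N}}}$, written as $A_N/B_N$, where $A_{-1}=1$, $A_0=0$, $B_{-1}=0$, $B_0=1$, and $A_n=b_nA_{n-1}+a_nA_{n-2}$, $B_n=b_nB_{n-1}+a_nB_{n-2}$ for $n\ge1$. $K_{n=1}^{\infty}\frac{a_n}{b_n}$ denotes $\lim_{N\to\infty}A_N/B_N$, if this limit exists. *)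

theory Defs
  imports "HOL-Analysis.Analysis"
begin

text \<open>
  Partial numerators \<open>a\<close> and denominators \<open>b\<close> are indexed from 1; the values \<open>a 0\<close> and \<open>b 0\<close>
  are never used. Since the index is a natural number, the initial values
  \<open>A\<^sub>-\<^sub>1 = 1\<close> and \<open>B\<^sub>-\<^sub>1 = 0\<close> appear inlined in the equation for index 1.
\<close>

fun cf_num :: "(nat \<Rightarrow> 'a::field) \<Rightarrow> (nat \<Rightarrow> 'a) \<Rightarrow> nat \<Rightarrow> 'a" where
  "cf_num a b 0 = 0"
| "cf_num a b (Suc 0) = b 1 * cf_num a b 0 + a 1 * 1"
| "cf_num a b (Suc (Suc n)) =
     b (Suc (Suc n)) * cf_num a b (Suc n) + a (Suc (Suc n)) * cf_num a b n"

fun cf_den :: "(nat \<Rightarrow> 'a::field) \<Rightarrow> (nat \<Rightarrow> 'a) \<Rightarrow> nat \<Rightarrow> 'a" where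
  "cf_den a b 0 = 1"
| "cf_den a b (Suc 0) = b 1 * cf_den a b 0 + a 1 * 0"
| "cf_den a b (Suc (Suc n)) =
     b (Suc (Suc n)) * cf_den a b (Suc n) + a (Suc (Suc n)) * cf_den a b n"

definition cf_approx :: "(nat \<Rightarrow> 'a::field) \<Rightarrow> (nat \<Rightarrow> 'a) \<Rightarrow> nat \<Rightarrow> 'a" where
  "cf_approx a b N = cf_num a b N / cf_den a b N"

text \<open>
  The condition on the denominators excludes spurious limits coming from \<open>x / 0 = 0\<close>.
\<close>

definition cf_converges :: "(nat \<Rightarrow> 'a::real_normed_field) \<Rightarrow> (nat \<Rightarrow> 'a) \<Rightarrow> bool" where
  "cf_converges a b \<longleftrightarrow>
     (\<forall>\<^sub>F N in sequentially. cf_den a b N \<noteq> 0) \<and> convergent (cf_approx a b)"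

definition cf_value :: "(nat \<Rightarrow> 'a::real_normed_field) \<Rightarrow> (nat \<Rightarrow> 'a) \<Rightarrow> 'a" where
  "cf_value a b = lim (cf_approx a b)"

text \<open>
  \<open>cf_nested a b m k\<close> is the nested fraction with the \<open>k\<close> levels \<open>m, \<dots>, m + k - 1\<close>. The lemma
  \<open>cf_nested_eq_approx\<close> confirms that the recurrences above compute it.
\<close>

fun cf_nested :: "(nat \<Rightarrow> 'a::field) \<Rightarrow> (nat \<Rightarrow> 'a) \<Rightarrow> nat \<Rightarrow> nat \<Rightarrow> 'a" where
  "cf_nested a b m 0 = 0"
| "cf_nested a b m (Suc k) = a m / (b m + cf_nested a b (Suc m) k)"

lemma cf_nested_nonneg:
  fixes a b :: "nat \<Rightarrow> real"
  assumes "\<And>n. n \<ge> 1 \<Longrightarrow> a n > 0" and "\<And>n. n \<ge> 1 \<Longrightarrow> b n > 0" and "m \<ge> 1"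
  shows "cf_nested a b m k \<ge> 0"
  using assms(3)
proof (induction k arbitrary: m)
  case (Suc k)
  then show ?case
    using assms(1,2)[of m] Suc.IH[of "Suc m"] by (auto intro!: divide_nonneg_nonneg)
qed simp

lemma cf_nested_eq_approx:
  fixes a b :: "nat \<Rightarrow> real"
  assumes a: "\<And>n. n \<ge> 1 \<Longrightarrow> a n > 0" and b: "\<And>n. n \<ge> 1 \<Longrightarrow> b n > 0"
  shows "cf_nested a b 1 N = cf_approx a b N"
proof -
  have step: "(p + q * (c / (d + t))) / (r + s * (c / (d + t)))
      = (d * p + c * q + p * t) / (d * r + c * s + r * t)"
    if "d + t > 0" for p q r s c d t :: real
  proof -
    have "p + q * (c / (d + t)) = (d * p + c * q + p * t) / (d + t)"
         "r + s * (c / (d + t)) = (d * r + c * s + r * t) / (d + t)"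
      using that by (auto simp: field_simps)
    then show ?thesis
      using that by simp
  qed
  have pos: "b m + cf_nested a b (Suc m) k > 0" if "m \<ge> 1" for m k
  proof -
    have "cf_nested a b (Suc m) k \<ge> 0"
      by (rule cf_nested_nonneg) (use a b in auto)
    then show ?thesis
      using b[OF that] by linarith
  qed
  have gen: "(cf_num a b (Suc n) + cf_num a b n * cf_nested a b (Suc (Suc n)) k) /
        (cf_den a b (Suc n) + cf_den a b n * cf_nested a b (Suc (Suc n)) k)
      = cf_approx a b (Suc n + k)" for n k
  proof (induction k arbitrary: n)
    case 0
    then show ?case by (simp add: cf_approx_def)
  next
    case (Suc k)
    show ?case
      using step[OF pos[of "Suc (Suc n)" k]] Suc.IH[of "Suc n"] by simp
  qed
  show ?thesis
  proof (cases N)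
    case 0
    then show ?thesis by (simp add: cf_approx_def)
  next
    case (Suc k)
    then show ?thesis
      using gen[of 0 k] by (simp add: numeral_2_eq_2)
  qed
qed

end

(* With a_n = b_n + 1, the sequence (-1)^n solves the recurrence of numerators and denominators.
   Hence A_n - B_n = (-1)^(n+1), so that A_n / B_n = 1 + (-1)^(n+1) / B_n, and B_n \<ge> n. *)

theory Submission
  imports Defs
begin

text \<open>Numerators A and denominators B both solve x_n = b_n x_(n-1) + (b_n + 1) x_(n-2), and so
  does (-1)^n. As A - B starts with -1, 1, it equals (-1)^(n+1)
  (\<open>cf_num_eq_cf_den_plus\<close>). Since B grows without bound (\<open>cf_den_ge\<close>),
  A/B differs from 1 by a vanishing term.\<close>

lemma cf_num_eq_cf_den_plus:
  fixes b :: "nat \<Rightarrow> 'a::field"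
  shows "cf_num (\<lambda>n. b n + 1) b n = cf_den (\<lambda>n. b n + 1) b n + (- 1) ^ Suc n"
proof (induction n rule: induct_nat_012)
  case (ge2 n)
  show ?case
    unfolding cf_num.simps cf_den.simps ge2 by (simp add: algebra_simps)
qed simp_all

text \<open>Each new denominator is at least B_(n+1) + 2 B_n. The bound 1 inside \<open>max\<close>
  makes the second term contribute at least 2, which carries the linear growth; it also keeps B
  positive at n = 0.\<close>

lemma cf_den_ge:
  fixes b :: "nat \<Rightarrow> real"
  assumes b: "\<And>n. n \<ge> 1 \<Longrightarrow> b n \<ge> 1"
  shows "cf_den (\<lambda>n. b n + 1) b n \<ge> max 1 (real n)"
proof (induction n rule: induct_nat_012)
  case (ge2 n)
  let ?B = "cf_den (\<lambda>n. b n + 1) b" and ?c = "b (Suc (Suc n))"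
  have c: "?c \<ge> 1"
    using b by simp
  have "1 * ?B (Suc n) \<le> ?c * ?B (Suc n)" "2 * ?B n \<le> (?c + 1) * ?B n"
    using c ge2 by (auto intro!: mult_right_mono)
  then show ?case
    using ge2 unfolding cf_den.simps max.bounded_iff by linarith
qed (use b in auto)

theorem mainTheorem1:
  fixes b :: "nat \<Rightarrow> real"
  assumes "\<And>n. n \<ge> 1 \<Longrightarrow> b n > 0"
    and "\<And>n. n \<ge> 1 \<Longrightarrow> b n \<ge> 1"
  shows "cf_converges (\<lambda>n. b n + 1) b \<and> cf_value (\<lambda>n. b n + 1) b = 1"
proof -
  let ?a = "\<lambda>n. b n + 1"
  have ge: "cf_den ?a b n \<ge> max 1 (real n)" for n
    using assms(2) by (rule cf_den_ge)
  \<comment> \<open>Needed both to split the quotient A/B and for the nonvanishing clause of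
    \<open>cf_converges\<close>.\<close>
  have nz: "cf_den ?a b n \<noteq> 0" for n
    using ge[of n] by auto
  have "filterlim (cf_den ?a b) at_top sequentially"
    using ge by (intro filterlim_at_top_mono[OF filterlim_real_sequentially]) auto
  then have "(\<lambda>n. 1 / cf_den ?a b n) \<longlonglongrightarrow> 0"
    by (intro tendsto_divide_0[OF tendsto_const] filterlim_at_top_imp_at_infinity)
  then have "(\<lambda>n. (- 1) ^ Suc n / cf_den ?a b n) \<longlonglongrightarrow> 0"
    \<comment> \<open>The alternating sign disappears on passing to absolute values, where both
      sequences agree.\<close>
    by (rule tendsto_rabs_zero_cancel[OF Lim_transform_eventually[OF tendsto_rabs_zero]])
       (simp add: abs_divide power_abs)
  then have "(\<lambda>n. 1 + (- 1) ^ Suc n / cf_den ?a b n) \<longlonglongrightarrow> 1 + 0"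
    by (intro tendsto_add tendsto_const)
  moreover have "cf_approx ?a b = (\<lambda>n. 1 + (- 1) ^ Suc n / cf_den ?a b n)"
    unfolding cf_approx_def fun_eq_iff cf_num_eq_cf_den_plus
    using nz by (simp add: add_divide_distrib diff_divide_distrib)
  ultimately have lim: "cf_approx ?a b \<longlonglongrightarrow> 1"
    by simp
  then show ?thesis
    using nz by (auto simp: cf_converges_def cf_value_def convergent_def limI)
qed

end
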